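(* Let $p:\mathbb{R}^n \to \mathbb{R}$ be a function. Then $p$ is positively homogeneous and Lipschitz continuous on $\mathbb{R}^n$ if and only if there exist index sets $I$ and $S$, a two-index family of vectors $\{a_{is} \in \mathbb{R}^n \,|\, i \in I,\ s \in S\}$ and a real constant $M>0$ such that, for each $x \in \mathbb{R}^n$, $$-M\|x\| \le \inf_{i \in I}\langle a_{is}, x \rangle \quad \forall\, s \in S \qquad\text{and}\qquad \sup_{s \in S}\langle a_{is}, x \rangle \le M\|x\| \quad \forall\, i \in I,$$ and $$p(x) = \inf_{i \in I}\sup_{s \in S}\langle a_{is}, x \rangle = \sup_{s \in S}\inf_{i \in I}\langle a_{is}, x \rangle \quad \forall\, x \in \mathbb{R}^n.$$
   Context: A function $p:\mathbb{R}^n\to\mathbb{R}$ is positively homogeneous if $p(\lambda x)=\lambda p(x)$ for all $x\in\mathbb{R}^n$ and all real $\lambda>0$. $\langle\cdot,\cdot\rangle$ denotes the standard inner product on $\mathbb{R}^n$ and $\|\cdot\|$ the Euclidean norm. The index sets $I$ and $S$ are arbitrary (possibly infinite). Infima and suprema are taken in the extended reals. Lipschitz continuous on $\mathbb{R}^n$ means globally Lipschitz: there is $L\ge 0$ with $|p(x)-p(y)|\le L\|x-y\|$ for all $x,y\in\mathbb{R}^n$. *)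

theory Defs
  imports "HOL-Analysis.Analysis"
begin

definition positively_homogeneous :: "(real^'n \<Rightarrow> real) \<Rightarrow> bool" where
  "positively_homogeneous p \<longleftrightarrow> (\<forall>x. \<forall>t>0. p (t *\<^sub>R x) = t * p x)"

text \<open>Infima and suprema are taken in \<^typ>\<open>ereal\<close>, so that they exist for arbitrary index
  sets (the infimum over the empty set is \<open>\<infinity>\<close>, the supremum is \<open>-\<infinity>\<close>). Only the values
  \<open>a i s\<close> with \<open>i \<in> I\<close> and \<open>s \<in> S\<close> matter.\<close>

definition bounded_saddle_representation ::
  "(real^'n \<Rightarrow> real) \<Rightarrow> 'i set \<Rightarrow> 's set \<Rightarrow> ('i \<Rightarrow> 's \<Rightarrow> real^'n) \<Rightarrow> real \<Rightarrow> bool" where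
  "bounded_saddle_representation p I S a M \<longleftrightarrow>
     (\<forall>x.
        (\<forall>s\<in>S. ereal (- M * norm x) \<le> (INF i\<in>I. ereal (a i s \<bullet> x))) \<and>
        (\<forall>i\<in>I. (SUP s\<in>S. ereal (a i s \<bullet> x)) \<le> ereal (M * norm x))) \<and>
     (\<forall>x.
        ereal (p x) = (INF i\<in>I. SUP s\<in>S. ereal (a i s \<bullet> x)) \<and>
        ereal (p x) = (SUP s\<in>S. INF i\<in>I. ereal (a i s \<bullet> x)))"

end

theory Submission
  imports Defs
begin

text \<open>Holding at \<open>x\<close> and at \<open>-x\<close>, each of the two bounds in the representation says that
  \<open>norm (a i s) \<le> M\<close> for all \<open>i\<close> and \<open>s\<close>. A value of an inf-sup of the numbers \<open>a i s \<bullet> x\<close> depends on them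
  monotonically and commutes with positive affine maps, so it inherits from the linear functionals
  both positive homogeneity and the Lipschitz constant \<open>M\<close> (\<open>infsup_affine_mono\<close>).

  For the converse, let both index sets consist of all vectors. Since sup-inf never exceeds inf-sup,
  both formulas follow as soon as the index \<open>i = x\<close> gives \<open>sup \<le> p x\<close> and the index \<open>s = x\<close> gives
  \<open>inf \<ge> p x\<close>. So what is needed is a single vector \<open>a\<close> for each pair \<open>y, z\<close>, of norm bounded
  uniformly in the pair, with \<open>a \<bullet> y \<le> p y\<close> and \<open>a \<bullet> z \<ge> p z\<close>. By homogeneity it suffices to treat
  unit vectors \<open>u, v\<close>. There \<open>p u *\<^sub>R u\<close> takes the right value at \<open>u\<close>, and adding a nonnegative
  multiple of \<open>v - u\<close> lowers the value at \<open>u\<close> and raises the value at \<open>v\<close>; the Lipschitz condition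
  says that a multiple of bounded length is enough (\<open>two_point_interpolation_unit\<close>).\<close>

section \<open>Inf-sup families of bounded linear functionals\<close>

text \<open>Both homogeneity (\<open>d = 0\<close>) and the Lipschitz estimate (\<open>c = 1\<close>) are instances: an inequality
  between the functionals at \<open>x\<close> and a positive affine image of their values at \<open>y\<close> survives the
  supremum and then the infimum.\<close>

lemma infsup_affine_mono:
  fixes f g :: "'i \<Rightarrow> 's \<Rightarrow> real"
  assumes P: "ereal P = (INF i\<in>I. SUP s\<in>S. ereal (f i s))"
    and Q: "ereal Q = (INF i\<in>I. SUP s\<in>S. ereal (g i s))"
    and c: "c > 0"
    and le: "\<And>i s. i \<in> I \<Longrightarrow> s \<in> S \<Longrightarrow> f i s \<le> c * g i s + d"
  shows "P \<le> c * Q + d"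
proof -
  have "ereal ((P - d) / c) \<le> (SUP s\<in>S. ereal (g i s))" if i: "i \<in> I" for i
  proof -
    define B where "B = (SUP s\<in>S. ereal (g i s))"
    have up: "ereal (f i s) \<le> ereal c * B + ereal d" if s: "s \<in> S" for s
    proof -
      have "ereal (g i s) \<le> B"
        unfolding B_def using s by (rule SUP_upper)
      then have "ereal c * ereal (g i s) + ereal d \<le> ereal c * B + ereal d"
        using c by (intro add_right_mono ereal_mult_left_mono) auto
      moreover have "ereal (f i s) \<le> ereal c * ereal (g i s) + ereal d"
        using le[OF i s] by simp
      ultimately show ?thesis by (rule order_trans[rotated])
    qed
    have "ereal P \<le> (SUP s\<in>S. ereal (f i s))"
      unfolding P using i by (rule INF_lower)
    also have "\<dots> \<le> ereal c * B + ereal d"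
      using up by (rule SUP_least)
    finally have "ereal P \<le> ereal c * B + ereal d" .
    then have "ereal ((P - d) / c) \<le> B"
      using c by (cases B) (auto simp: field_simps)
    then show ?thesis by (simp add: B_def)
  qed
  then have "ereal ((P - d) / c) \<le> ereal Q"
    unfolding Q by (rule INF_greatest)
  then show ?thesis using c by (simp add: field_simps)
qed

lemma bounded_saddle_representation_inner_le:
  assumes rep: "bounded_saddle_representation p I S a M" and i: "i \<in> I" and s: "s \<in> S"
  shows "a i s \<bullet> x \<le> M * norm x"
proof -
  have "ereal (a i s \<bullet> x) \<le> (SUP s\<in>S. ereal (a i s \<bullet> x))"
    using s by (rule SUP_upper)
  also have "\<dots> \<le> ereal (M * norm x)"
    using rep i by (auto simp: bounded_saddle_representation_def)
  finally show ?thesis by simp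
qed

lemma bounded_saddle_representation_infsup:
  assumes "bounded_saddle_representation p I S a M"
  shows "ereal (p x) = (INF i\<in>I. SUP s\<in>S. ereal (a i s \<bullet> x))"
  using assms by (auto simp: bounded_saddle_representation_def)

lemma bounded_saddle_representation_imp_positively_homogeneous:
  assumes rep: "bounded_saddle_representation p I S a M"
  shows "positively_homogeneous p"
proof -
  note infsup = bounded_saddle_representation_infsup[OF rep]
  have "p (t *\<^sub>R x) = t * p x" if t: "t > 0" for t x
  proof (rule antisym)
    show "p (t *\<^sub>R x) \<le> t * p x"
      using infsup_affine_mono[OF infsup[of "t *\<^sub>R x"] infsup[of x] t, of 0] by simp
    have "p x \<le> (1 / t) * p (t *\<^sub>R x)"
      using infsup_affine_mono[OF infsup[of x] infsup[of "t *\<^sub>R x"], of "1 / t" 0] t by simp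
    then show "t * p x \<le> p (t *\<^sub>R x)"
      using t by (simp add: field_simps)
  qed
  then show ?thesis by (simp add: positively_homogeneous_def)
qed

lemma bounded_saddle_representation_imp_lipschitz:
  assumes rep: "bounded_saddle_representation p I S a M" and M: "M \<ge> 0"
  shows "M-lipschitz_on UNIV p"
proof (rule lipschitz_onI)
  note infsup = bounded_saddle_representation_infsup[OF rep]
  have le: "p x \<le> p y + M * norm (x - y)" for x y
  proof -
    have "a i s \<bullet> x \<le> 1 * (a i s \<bullet> y) + M * norm (x - y)" if "i \<in> I" "s \<in> S" for i s
      using bounded_saddle_representation_inner_le[OF rep that, of "x - y"]
      by (simp add: inner_diff_right)
    from infsup_affine_mono[OF infsup[of x] infsup[of y] zero_less_one this]
    show ?thesis by simp
  qed
  show "dist (p x) (p y) \<le> M * dist x y" for x y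
    using le[of x y] le[of y x] by (simp add: dist_norm norm_minus_commute abs_le_iff)
qed (fact M)

section \<open>Interpolation at two points\<close>

text \<open>With \<open>d = v - u\<close>, one has \<open>d \<bullet> v = - (d \<bullet> u) = (norm d)\<^sup>2 / 2\<close>, so moving \<open>q *\<^sub>R u\<close> along \<open>d\<close> acts
  at the two points in opposite directions. The gain needed at \<open>v\<close> is
  \<open>r - q * (u \<bullet> v) = (r - q) + q * (norm d)\<^sup>2 / 2 \<le> L * norm d + L * (norm d)\<^sup>2 / 2\<close>; this is of first
  order in \<open>norm d\<close>, and a vector of length of order \<open>L\<close> in direction \<open>d\<close> supplies it.\<close>

lemma two_point_interpolation_unit:
  fixes u v :: "'a::real_inner"
  assumes u: "norm u = 1" and v: "norm v = 1"
    and q: "\<bar>q\<bar> \<le> L" and r: "r - q \<le> L * norm (v - u)"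
  obtains a where "norm a \<le> 5 * L" "a \<bullet> u \<le> q" "r \<le> a \<bullet> v"
proof
  define d where "d = v - u"
  \<comment> \<open>For \<open>u = v\<close> the quotient is \<open>0\<close> and \<open>d = 0\<close>, so that \<open>a\<close> below is just \<open>q *\<^sub>R u\<close>.\<close>
  define k where "k = 2 * L / norm d + L"
  define a where "a = q *\<^sub>R u + k *\<^sub>R d"
  have L: "L \<ge> 0" using q by linarith
  have k: "k \<ge> 0" using L by (simp add: k_def)
  have uu: "u \<bullet> u = 1" and vv: "v \<bullet> v = 1"
    using u v by (simp_all add: norm_eq_1)
  have sq: "(norm d)\<^sup>2 = 2 - 2 * (u \<bullet> v)"
    by (simp add: d_def power2_norm_eq_inner inner_diff uu vv inner_commute)
  have du: "d \<bullet> u = - ((norm d)\<^sup>2 / 2)" and dv: "d \<bullet> v = (norm d)\<^sup>2 / 2"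
    by (simp_all add: sq) (simp_all add: d_def inner_diff uu vv inner_commute field_simps)
  have kd: "k * norm d \<le> 2 * L + L * norm d"
    using L by (simp add: k_def field_simps)
  have k2: "k * ((norm d)\<^sup>2 / 2) = L * norm d + L * ((norm d)\<^sup>2 / 2)"
    by (simp add: k_def field_simps power2_eq_square)
  have "norm d \<le> 2"
    unfolding d_def using norm_triangle_ineq4[of v u] u v by simp
  then have Ld: "L * norm d \<le> L * 2"
    using L by (rule mult_left_mono)
  have "norm a \<le> \<bar>q\<bar> + k * norm d"
    unfolding a_def using norm_triangle_ineq[of "q *\<^sub>R u" "k *\<^sub>R d"] u k by simp
  then show "norm a \<le> 5 * L"
    using q kd Ld by linarith
  have "a \<bullet> u = q - k * ((norm d)\<^sup>2 / 2)"
    by (simp add: a_def inner_add_left uu du)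
  then show "a \<bullet> u \<le> q" using k by simp
  have uv: "u \<bullet> v = 1 - (norm d)\<^sup>2 / 2" using sq by linarith
  have av: "a \<bullet> v = q - q * ((norm d)\<^sup>2 / 2) + k * ((norm d)\<^sup>2 / 2)"
    by (simp add: a_def inner_add_left uv dv algebra_simps)
  have "q * ((norm d)\<^sup>2 / 2) \<le> L * ((norm d)\<^sup>2 / 2)"
    using q by (intro mult_right_mono) auto
  then show "r \<le> a \<bullet> v"
    using r unfolding av k2 d_def[symmetric] by linarith
qed

lemma unit_direction:
  fixes y :: "real^'n"
  obtains u where "norm u = 1" "y = norm y *\<^sub>R u"
proof (cases "y = 0")
  case True
  obtain u :: "real^'n" where "norm u = 1"
    using vector_choose_size[of 1] by auto
  with True that show ?thesis by simp
next
  case False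
  then show ?thesis using that[of "y /\<^sub>R norm y"] by simp
qed

lemma positively_homogeneous_zero:
  assumes "positively_homogeneous p"
  shows "p 0 = 0"
proof -
  have "p (2 *\<^sub>R 0) = 2 * p 0"
    using assms unfolding positively_homogeneous_def by (metis zero_less_numeral)
  then show ?thesis by simp
qed

lemma two_point_interpolation:
  assumes hom: "positively_homogeneous p" and lip: "L-lipschitz_on UNIV p"
  obtains a where "norm a \<le> 5 * L" "a \<bullet> y \<le> p y" "p z \<le> a \<bullet> z"
proof -
  note p0 = positively_homogeneous_zero[OF hom]
  have scale: "p (t *\<^sub>R x) = t * p x" if "t \<ge> 0" for t x
    using hom p0 that by (cases "t = 0") (auto simp: positively_homogeneous_def)
  have dist: "\<bar>p x - p x'\<bar> \<le> L * norm (x - x')" for x x'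
    using lipschitz_onD[OF lip, of x x'] by (simp add: dist_norm)
  obtain u where u: "norm u = 1" "y = norm y *\<^sub>R u" by (rule unit_direction)
  obtain v where v: "norm v = 1" "z = norm z *\<^sub>R v" by (rule unit_direction)
  have "\<bar>p u\<bar> \<le> L" using dist[of u 0] p0 u by simp
  moreover have "p v - p u \<le> L * norm (v - u)" using dist[of v u] by linarith
  ultimately obtain a where a: "norm a \<le> 5 * L" "a \<bullet> u \<le> p u" "p v \<le> a \<bullet> v"
    using two_point_interpolation_unit[OF u(1) v(1)] by metis
  have "norm y * (a \<bullet> u) \<le> norm y * p u" "norm z * p v \<le> norm z * (a \<bullet> v)"
    using a by (auto intro: mult_left_mono)
  then have "a \<bullet> (norm y *\<^sub>R u) \<le> p (norm y *\<^sub>R u)" "p (norm z *\<^sub>R v) \<le> a \<bullet> (norm z *\<^sub>R v)"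
    by (simp_all add: scale)
  then show thesis using that a(1) u(2) v(2) by metis
qed

section \<open>Saddle representation\<close>

text \<open>The diagonal choice of indices: row \<open>x\<close> bounds inf-sup from above by \<open>p x\<close>, column \<open>x\<close> bounds
  sup-inf from below by \<open>p x\<close>, and the minimax inequality closes the gap.\<close>

lemma bounded_saddle_representation_of_interpolation:
  assumes bound: "\<And>y z. norm (a y z) \<le> M"
    and row: "\<And>y z. a y z \<bullet> y \<le> p y" and col: "\<And>y z. p z \<le> a y z \<bullet> z"
  shows "bounded_saddle_representation p UNIV UNIV a M"
proof -
  have cs: "\<bar>a y z \<bullet> x\<bar> \<le> M * norm x" for x y z
    using Cauchy_Schwarz_ineq2[of "a y z" x] mult_right_mono[OF bound[of y z], of "norm x"]
    by simp
  have bounds: "- (M * norm x) \<le> a y z \<bullet> x" "a y z \<bullet> x \<le> M * norm x" for x y z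
    using cs[of y z x] by (simp_all add: abs_le_iff)
  have "(INF y. SUP z. ereal (a y z \<bullet> x)) = ereal (p x)"
    "(SUP z. INF y. ereal (a y z \<bullet> x)) = ereal (p x)" for x
  proof -
    have "(INF y. SUP z. ereal (a y z \<bullet> x)) \<le> (SUP z. ereal (a x z \<bullet> x))"
      by (rule INF_lower) simp
    also have "\<dots> \<le> ereal (p x)" by (rule SUP_least) (simp add: row)
    finally have upper: "(INF y. SUP z. ereal (a y z \<bullet> x)) \<le> ereal (p x)" .
    have "ereal (p x) \<le> (INF y. ereal (a y x \<bullet> x))"
      by (rule INF_greatest) (simp add: col)
    also have "\<dots> \<le> (SUP z. INF y. ereal (a y z \<bullet> x))"
      by (rule SUP_upper) simp
    finally have lower: "ereal (p x) \<le> (SUP z. INF y. ereal (a y z \<bullet> x))" .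
    have "(SUP z. INF y. ereal (a y z \<bullet> x)) \<le> (INF y. SUP z. ereal (a y z \<bullet> x))"
    proof (intro SUP_least INF_greatest)
      fix y z
      have "(INF y. ereal (a y z \<bullet> x)) \<le> ereal (a y z \<bullet> x)"
        by (rule INF_lower) simp
      also have "\<dots> \<le> (SUP z. ereal (a y z \<bullet> x))"
        by (rule SUP_upper) simp
      finally show "(INF y. ereal (a y z \<bullet> x)) \<le> (SUP z. ereal (a y z \<bullet> x))" .
    qed
    with upper lower show "(INF y. SUP z. ereal (a y z \<bullet> x)) = ereal (p x)"
      "(SUP z. INF y. ereal (a y z \<bullet> x)) = ereal (p x)"
      by (auto intro: antisym order_trans)
  qed
  then show ?thesis
    by (auto simp: bounded_saddle_representation_def bounds intro!: INF_greatest SUP_least)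
qed

lemma positively_homogeneous_lipschitz_imp_bounded_saddle_representation:
  fixes p :: "real^'n \<Rightarrow> real"
  assumes hom: "positively_homogeneous p" and lip: "L-lipschitz_on UNIV p"
  obtains a :: "real^'n \<Rightarrow> real^'n \<Rightarrow> real^'n" and M
  where "M > 0" "bounded_saddle_representation p UNIV UNIV a M"
proof -
  have L: "L \<ge> 0" using lip by (rule lipschitz_on_nonneg)
  have "\<forall>y z. \<exists>a. norm a \<le> 5 * L \<and> a \<bullet> y \<le> p y \<and> p z \<le> a \<bullet> z"
    using two_point_interpolation[OF hom lip] by metis
  then obtain a where a: "\<And>y z. norm (a y z) \<le> 5 * L \<and> a y z \<bullet> y \<le> p y \<and> p z \<le> a y z \<bullet> z"
    by metis
  \<comment> \<open>The summand \<open>1\<close> keeps the constant positive when \<open>L = 0\<close>.\<close>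
  have "norm (a y z) \<le> 5 * L + 1" for y z
    using a[of y z] by simp
  then have "bounded_saddle_representation p UNIV UNIV a (5 * L + 1)"
    using a by (intro bounded_saddle_representation_of_interpolation) auto
  with L that[of "5 * L + 1" a] show thesis by simp
qed

(* Quantification over types is not available inside a formula, so the equivalence is stated
   for index sets of vectors, and the second conjunct extends its "if" direction to index
   sets in arbitrary types 'i and 's. For "only if" the concrete index type gives the
   existence of some index sets, which is what is claimed. *)
theorem theorem2:
  fixes p :: "real^'n \<Rightarrow> real"
  shows "((positively_homogeneous p \<and> (\<exists>L. L-lipschitz_on UNIV p)) \<longleftrightarrow>
            (\<exists>(I :: (real^'n) set) (S :: (real^'n) set) a M.
               M > 0 \<and> bounded_saddle_representation p I S a M)) \<and>
         ((\<exists>(I :: 'i set) (S :: 's set) a M.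
               M > 0 \<and> bounded_saddle_representation p I S a M) \<longrightarrow>
            (positively_homogeneous p \<and> (\<exists>L. L-lipschitz_on UNIV p)))"
proof (intro conjI iffI impI)
  assume "positively_homogeneous p \<and> (\<exists>L. L-lipschitz_on UNIV p)"
  then obtain L where "positively_homogeneous p" "L-lipschitz_on UNIV p" by blast
  then obtain a :: "real^'n \<Rightarrow> real^'n \<Rightarrow> real^'n" and M
    where "M > 0" "bounded_saddle_representation p UNIV UNIV a M"
    by (rule positively_homogeneous_lipschitz_imp_bounded_saddle_representation)
  then show "\<exists>(I :: (real^'n) set) (S :: (real^'n) set) a M.
      M > 0 \<and> bounded_saddle_representation p I S a M"
    by blast
qed (auto intro: bounded_saddle_representation_imp_positively_homogeneous
    bounded_saddle_representation_imp_lipschitz less_imp_le)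

end
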